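(* Let $\Gamma$ be a set. If $K\subset 2^\Gamma$ is a nonmetrizable scattered compact space such that $\sigma(\Gamma)\cap K$ is dense in $K$, then $K$ does not belong to $\mathcal{RS}$. In particular, nonmetrizable scattered Corson compacta do not belong to $\mathcal{RS}$.
   Context: All topological spaces are assumed Hausdorff. For $x\in\mathbb R^\Gamma$, $\operatorname{suppt}(x)=\{\gamma\in\Gamma:x(\gamma)\ne0\}$; $\sigma(\Gamma)=\{x\in\mathbb R^\Gamma:\operatorname{suppt}(x)\text{ is finite}\}$ and $\Sigma(\Gamma)=\{x\in\mathbb R^\Gamma:\operatorname{suppt}(x)\text{ is countable}\}$. $2^\Gamma=\{0,1\}^\Gamma\subset\mathbb R^\Gamma$ with the product topology. A compact space is Corson if it is homeomorphic to a compact subset of $\Sigma(\Gamma)$ for some set $\Gamma$. A space is scattered if each of its nonempty subspaces has an isolated point. The class $\mathcal{RS}$: a compact space $K$ belongs to $\mathcal{RS}$ if $K$ is the inverse limit of a continuous inverse system of compact metric spaces $\mathbb S=\big((K_\alpha)_{\alpha\in\omega_1},(p_\alpha^\beta)_{\alpha\le\beta}\big)$ such that every bonding map $p_\alpha^\beta:K_\beta\to K_\alpha$, $\alpha\le\beta<\omega_1$, is a semi-open retraction. Here an inverse system consists of continuous onto maps with $p_\alpha^\alpha=\mathrm{id}$ and $p_\alpha^\gamma=p_\alpha^\beta\circ p_\beta^\gamma$ for $\alpha\le\beta\le\gamma$; it is continuous if for every nonempty $T\subset\omega_1$ with supremum $t\in\omega_1$, $\big(K_t,(p_s^t)_{s\in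 T}\big)$ is the inverse limit of the restriction of $\mathbb S$ to $T$. A map $f:X\to Y$ is semi-open if $f[U]$ has nonempty interior in $Y$ for every nonempty open $U\subset X$; a retraction $r:X\to Y$ is a continuous map admitting a continuous right inverse. *)

theory Defs
  imports "HOL-Analysis.Analysis"
begin

text \<open>\<open>\<real>\<^sup>\<Gamma>\<close> for a set \<open>\<Gamma>\<close>: its points are the functions that are \<open>undefined\<close> outside \<open>\<Gamma>\<close>.\<close>

definition real_power :: "'i set \<Rightarrow> ('i \<Rightarrow> real) topology"
  where "real_power \<Gamma> = product_topology (\<lambda>_. euclideanreal) \<Gamma>"

definition two_power :: "'i set \<Rightarrow> ('i \<Rightarrow> real) set"
  where "two_power \<Gamma> = \<Gamma> \<rightarrow>\<^sub>E {0, 1}"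

definition suppt :: "'i set \<Rightarrow> ('i \<Rightarrow> real) \<Rightarrow> 'i set"
  where "suppt \<Gamma> x = {\<gamma> \<in> \<Gamma>. x \<gamma> \<noteq> 0}"

definition small_sigma :: "'i set \<Rightarrow> ('i \<Rightarrow> real) set"
  where "small_sigma \<Gamma> = {x \<in> topspace (real_power \<Gamma>). finite (suppt \<Gamma> x)}"

definition big_Sigma :: "'i set \<Rightarrow> ('i \<Rightarrow> real) set"
  where "big_Sigma \<Gamma> = {x \<in> topspace (real_power \<Gamma>). countable (suppt \<Gamma> x)}"

text \<open>A definition cannot quantify over the type of the index set \<open>\<Gamma>\<close>, so that type is a
  parameter.  A theorem assuming \<open>Corson_compact TYPE('i) X\<close> with \<open>'i\<close> a type variable covers
  index sets of every type.\<close>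

definition Corson_compact :: "'i itself \<Rightarrow> 'a topology \<Rightarrow> bool"
  where "Corson_compact _ X \<longleftrightarrow>
    (\<exists>(\<Gamma> :: 'i set) C. C \<subseteq> big_Sigma \<Gamma> \<and> compactin (real_power \<Gamma>) C \<and>
       X homeomorphic_space subtopology (real_power \<Gamma>) C)"

definition scattered_space :: "'a topology \<Rightarrow> bool"
  where "scattered_space X \<longleftrightarrow>
    (\<forall>A. A \<subseteq> topspace X \<and> A \<noteq> {} \<longrightarrow> (\<exists>x\<in>A. openin (subtopology X A) {x}))"

definition semi_open_map :: "'a topology \<Rightarrow> 'b topology \<Rightarrow> ('a \<Rightarrow> 'b) \<Rightarrow> bool"
  where "semi_open_map X Y f \<longleftrightarrow>
    (\<forall>U. openin X U \<and> U \<noteq> {} \<longrightarrow> Y interior_of (f ` U) \<noteq> {})"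

text \<open>The ordinal \<open>\<omega>\<^sub>1\<close> as a reflexive well-order; its elements are the members of its field.\<close>

definition omega1 :: "nat set rel"
  where "omega1 = cardSuc natLeq"

definition is_sup_omega1 :: "nat set set \<Rightarrow> nat set \<Rightarrow> bool"
  where "is_sup_omega1 T t \<longleftrightarrow>
    t \<in> Field omega1 \<and> (\<forall>s\<in>T. (s, t) \<in> omega1) \<and>
    (\<forall>u\<in>Field omega1. (\<forall>s\<in>T. (s, u) \<in> omega1) \<longrightarrow> (t, u) \<in> omega1)"

text \<open>In what follows \<open>p \<alpha> \<beta>\<close> is the bonding map \<open>p\<^sub>\<alpha>\<^sup>\<beta> : K\<^sub>\<beta> \<rightarrow> K\<^sub>\<alpha>\<close>; only its values
  on \<open>topspace (Ks \<beta>)\<close> matter.\<close>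

definition inverse_system ::
    "(nat set \<Rightarrow> 'b topology) \<Rightarrow> (nat set \<Rightarrow> nat set \<Rightarrow> 'b \<Rightarrow> 'b) \<Rightarrow> bool"
  where "inverse_system Ks p \<longleftrightarrow>
    (\<forall>\<alpha> \<beta>. (\<alpha>, \<beta>) \<in> omega1 \<longrightarrow>
       continuous_map (Ks \<beta>) (Ks \<alpha>) (p \<alpha> \<beta>) \<and>
       p \<alpha> \<beta> ` topspace (Ks \<beta>) = topspace (Ks \<alpha>)) \<and>
    (\<forall>\<alpha>\<in>Field omega1. \<forall>x\<in>topspace (Ks \<alpha>). p \<alpha> \<alpha> x = x) \<and>
    (\<forall>\<alpha> \<beta> \<gamma>. (\<alpha>, \<beta>) \<in> omega1 \<and> (\<beta>, \<gamma>) \<in> omega1 \<longrightarrow>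
       (\<forall>x\<in>topspace (Ks \<gamma>). p \<alpha> \<gamma> x = p \<alpha> \<beta> (p \<beta> \<gamma> x)))"

definition inverse_limit ::
    "nat set set \<Rightarrow> (nat set \<Rightarrow> 'b topology) \<Rightarrow> (nat set \<Rightarrow> nat set \<Rightarrow> 'b \<Rightarrow> 'b) \<Rightarrow>
     (nat set \<Rightarrow> 'b) topology"
  where "inverse_limit T Ks p =
    subtopology (product_topology Ks T)
      {x. \<forall>\<alpha>\<in>T. \<forall>\<beta>\<in>T. (\<alpha>, \<beta>) \<in> omega1 \<longrightarrow> x \<alpha> = p \<alpha> \<beta> (x \<beta>)}"

text \<open>The space \<open>X\<close> with projections \<open>q s\<close>, \<open>s \<in> T\<close>, is the inverse limit of the restriction of
  the system to \<open>T\<close>: the diagonal map of the projections is a homeomorphism onto the space of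
  threads.\<close>

definition is_inverse_limit ::
    "'a topology \<Rightarrow> (nat set \<Rightarrow> 'a \<Rightarrow> 'b) \<Rightarrow> nat set set \<Rightarrow>
     (nat set \<Rightarrow> 'b topology) \<Rightarrow> (nat set \<Rightarrow> nat set \<Rightarrow> 'b \<Rightarrow> 'b) \<Rightarrow> bool"
  where "is_inverse_limit X q T Ks p \<longleftrightarrow>
    homeomorphic_map X (inverse_limit T Ks p) (\<lambda>x. \<lambda>s\<in>T. q s x)"

definition continuous_system ::
    "(nat set \<Rightarrow> 'b topology) \<Rightarrow> (nat set \<Rightarrow> nat set \<Rightarrow> 'b \<Rightarrow> 'b) \<Rightarrow> bool"
  where "continuous_system Ks p \<longleftrightarrow>
    (\<forall>T t. T \<subseteq> Field omega1 \<and> T \<noteq> {} \<and> is_sup_omega1 T t \<longrightarrow>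
       is_inverse_limit (Ks t) (\<lambda>s. p s t) T Ks p)"

text \<open>The type \<open>'b\<close> carrying the spaces of the system is a parameter for the same reason as in
  \<open>Corson_compact\<close>.  A theorem concluding \<open>\<not> class_RS TYPE('b) K\<close> with \<open>'b\<close> a type variable
  excludes systems on every type.\<close>

definition class_RS :: "'b itself \<Rightarrow> 'a topology \<Rightarrow> bool"
  where "class_RS _ K \<longleftrightarrow>
    compact_space K \<and> Hausdorff_space K \<and>
    (\<exists>(Ks :: nat set \<Rightarrow> 'b topology) p q.
       inverse_system Ks p \<and> continuous_system Ks p \<and>
       (\<forall>\<alpha>\<in>Field omega1. compact_space (Ks \<alpha>) \<and> metrizable_space (Ks \<alpha>)) \<and>
       (\<forall>\<alpha> \<beta>. (\<alpha>, \<beta>) \<in> omega1 \<longrightarrow>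
          semi_open_map (Ks \<beta>) (Ks \<alpha>) (p \<alpha> \<beta>) \<and> retraction_map (Ks \<beta>) (Ks \<alpha>) (p \<alpha> \<beta>)) \<and>
       is_inverse_limit K q (Field omega1) Ks p)"

end

theory Submission
  imports Defs
begin

text \<open>
  Write \<open>q\<^sub>\<alpha>\<close> for the projections of a scattered \<open>K \<in> \<R>\<S>\<close>.  By semi-openness \<open>q\<^sub>\<alpha>\<close> maps isolated
  points to isolated points, and an isolated point is alone in its \<open>q\<^sub>\<alpha>\<close>-fibre for all large \<open>\<alpha>\<close>.
  Choose \<open>\<alpha>\<^sub>0 \<le> \<alpha>\<^sub>1 \<le> \<dots>\<close> such that every nonempty open set pulled back from stage \<open>\<alpha>\<^sub>n\<close>
  contains an isolated point that is alone in its fibre at stage \<open>\<alpha>\<^sub>n\<^sub>+\<^sub>1\<close>, and let \<open>t\<close> be the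
  supremum.  If \<open>y\<close> is isolated, the isolated point \<open>q\<^sub>t y\<close> is, by continuity of the system, cut out by
  an open set from some stage \<open>\<alpha>\<^sub>n\<close>, so its fibre contains one of the chosen points and is a singleton.
  Hence \<open>q\<^sub>t\<close> is injective on isolated points, and as \<open>K\<^sub>t\<close> is second countable there are only
  countably many of them.  They are dense in \<open>K\<close> and belong to every dense subset of \<open>K\<close>; so if
  \<open>\<Sigma>(\<Gamma>) \<inter> K\<close> is dense, all of \<open>K\<close> is supported by one countable set of coordinates and \<open>K\<close> is
  metrizable.
\<close>

section \<open>Order properties of \<open>omega1\<close>: bounds, suprema and finite maxima\<close>

lemma Well_order_omega1: "Well_order omega1"
  unfolding omega1_def using cardSuc_Card_order[OF natLeq_Card_order] card_order_on_well_order_on by blast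

lemma omega1_refl: "\<alpha> \<in> Field omega1 \<Longrightarrow> (\<alpha>, \<alpha>) \<in> omega1"
  using Well_order_omega1 wo_rel.REFL[unfolded wo_rel_def] by (metis refl_on_def)

lemma omega1_trans: "(\<alpha>, \<beta>) \<in> omega1 \<Longrightarrow> (\<beta>, \<gamma>) \<in> omega1 \<Longrightarrow> (\<alpha>, \<gamma>) \<in> omega1"
  using Well_order_omega1 wo_rel.TRANS[unfolded wo_rel_def] by (metis transD)

lemma omega1_total:
  "\<alpha> \<in> Field omega1 \<Longrightarrow> \<beta> \<in> Field omega1 \<Longrightarrow> (\<alpha>, \<beta>) \<in> omega1 \<or> (\<beta>, \<alpha>) \<in> omega1"
  using Well_order_omega1 wo_rel.TOTALS[unfolded wo_rel_def] by blast

lemma omega1_Field: "(\<alpha>, \<beta>) \<in> omega1 \<Longrightarrow> \<alpha> \<in> Field omega1" "(\<alpha>, \<beta>) \<in> omega1 \<Longrightarrow> \<beta> \<in> Field omega1"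
  by (auto intro: FieldI1 FieldI2)

lemma Field_omega1_nonempty: "Field omega1 \<noteq> {}"
proof
  assume "Field omega1 = {}"
  then have "finite (Field (cardSuc natLeq))" by (simp add: omega1_def)
  then show False
    using cardSuc_finite[OF natLeq_Card_order] by (simp add: Field_natLeq)
qed

text \<open>This is regularity of the successor cardinal: the initial segments \<open>under\<close>
  form an increasing chain covering \<open>T\<close>, and a set of size at most
  \<open>natLeq\<close> covered by such a chain lies in a single member.\<close>

lemma countable_bounded_omega1:
  includes cardinal_syntax
  assumes "countable T" "T \<subseteq> Field omega1"
  shows "\<exists>\<beta>\<in>Field omega1. \<forall>\<alpha>\<in>T. (\<alpha>, \<beta>) \<in> omega1"
proof -
  have "|T| \<le>o |UNIV :: nat set|"
    using assms(1) unfolding countable_def by (simp flip: card_of_ordLeq)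
  then have "|T| \<le>o natLeq"
    using card_of_nat ordLeq_ordIso_trans by blast
  moreover have "relChain (cardSuc natLeq) (under (cardSuc natLeq))"
    unfolding relChain_def under_def using omega1_trans[unfolded omega1_def] by blast
  moreover have "T \<subseteq> (\<Union>\<alpha>\<in>Field (cardSuc natLeq). under (cardSuc natLeq) \<alpha>)"
    using assms(2) omega1_refl unfolding omega1_def under_def by blast
  ultimately have "\<exists>\<beta>\<in>Field (cardSuc natLeq). T \<subseteq> under (cardSuc natLeq) \<beta>"
    by (intro cardSuc_UNION[OF natLeq_Card_order]) (simp_all add: Field_natLeq)
  then show ?thesis
    unfolding omega1_def under_def by blast
qed

lemma countable_sup_omega1:
  assumes "countable T" "T \<subseteq> Field omega1"
  shows "\<exists>t. is_sup_omega1 T t"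
proof -
  let ?B = "{\<beta> \<in> Field omega1. \<forall>\<alpha>\<in>T. (\<alpha>, \<beta>) \<in> omega1}"
  have wo: "wo_rel omega1" using Well_order_omega1 by (simp add: wo_rel_def)
  have B: "?B \<subseteq> Field omega1" "?B \<noteq> {}"
    using countable_bounded_omega1[OF assms] by auto
  have "wo_rel.minim omega1 ?B \<in> ?B" "\<forall>b\<in>?B. (wo_rel.minim omega1 ?B, b) \<in> omega1"
    using wo_rel.minim_in[OF wo B] wo_rel.minim_least[OF wo B(1)] by auto
  then show ?thesis unfolding is_sup_omega1_def by blast
qed

lemma finite_max_omega1:
  assumes "finite T" "T \<noteq> {}" "T \<subseteq> Field omega1"
  shows "\<exists>\<beta>\<in>T. \<forall>\<alpha>\<in>T. (\<alpha>, \<beta>) \<in> omega1"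
  using assms
proof (induction rule: finite_ne_induct)
  case (singleton x)
  then show ?case by (simp add: omega1_refl)
next
  case (insert x F)
  then obtain b where b: "b \<in> F" "\<forall>\<alpha>\<in>F. (\<alpha>, b) \<in> omega1" by auto
  have "x \<in> Field omega1" "b \<in> Field omega1" using insert.prems b(1) by auto
  then show ?case
    using b omega1_total[of x b] omega1_refl[of x] omega1_trans by (metis insert_iff)
qed

section \<open>Inverse limits: neighbourhoods and projections\<close>

lemma topspace_inverse_limit:
  "topspace (inverse_limit T Ks p) =
     {x \<in> (\<Pi>\<^sub>E \<alpha>\<in>T. topspace (Ks \<alpha>)). \<forall>\<alpha>\<in>T. \<forall>\<beta>\<in>T. (\<alpha>, \<beta>) \<in> omega1 \<longrightarrow> x \<alpha> = p \<alpha> \<beta> (x \<beta>)}"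
  by (auto simp: inverse_limit_def)

text \<open>A basic open set constrains only finitely many coordinates. In a thread, the coordinate
  at the greatest of these indices determines the others, so all constraints pull back along bonding
  maps to one open set at that stage.\<close>

lemma inverse_limit_nhd:
  assumes sys: "inverse_system Ks p" and T: "T \<subseteq> Field omega1" "T \<noteq> {}"
    and U: "openin (inverse_limit T Ks p) U" "x \<in> U"
  shows "\<exists>\<beta>\<in>T. \<exists>W. openin (Ks \<beta>) W \<and> x \<beta> \<in> W \<and>
           (\<forall>z\<in>topspace (inverse_limit T Ks p). z \<beta> \<in> W \<longrightarrow> z \<in> U)"
proof -
  let ?L = "{x. \<forall>\<alpha>\<in>T. \<forall>\<beta>\<in>T. (\<alpha>, \<beta>) \<in> omega1 \<longrightarrow> x \<alpha> = p \<alpha> \<beta> (x \<beta>)}"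
  obtain V where V: "openin (product_topology Ks T) V" "U = V \<inter> ?L"
    using U(1) unfolding inverse_limit_def openin_subtopology by blast
  obtain B where B: "finite {i \<in> T. B i \<noteq> topspace (Ks i)}" "\<forall>i\<in>T. openin (Ks i) (B i)"
      "x \<in> Pi\<^sub>E T B" "Pi\<^sub>E T B \<subseteq> V"
    using V U(2) by (auto simp: openin_product_topology_alt)
  define F where "F = {i \<in> T. B i \<noteq> topspace (Ks i)}"
  \<comment> \<open>If no coordinate is constrained, \<open>F\<close> is empty; adding
    \<open>t\<close> ensures that there is a greatest index.\<close>
  obtain t where t: "t \<in> T" using T(2) by blast
  have "finite (insert t F)" "insert t F \<noteq> {}" "insert t F \<subseteq> Field omega1"
    using B(1) T(1) t by (auto simp: F_def)
  from finite_max_omega1[OF this] obtain \<beta>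
    where \<beta>: "\<beta> \<in> insert t F" "\<forall>i\<in>F. (i, \<beta>) \<in> omega1" by auto
  have \<beta>T: "\<beta> \<in> T" using \<beta>(1) t by (auto simp: F_def)
  define W where "W = (\<Inter>i\<in>F. {w \<in> topspace (Ks \<beta>). p i \<beta> w \<in> B i}) \<inter> topspace (Ks \<beta>)"
  have "openin (Ks \<beta>) W"
    unfolding W_def
  proof (rule openin_INT)
    show "finite F" using B(1) by (simp add: F_def)
    fix i assume i: "i \<in> F"
    then have "continuous_map (Ks \<beta>) (Ks i) (p i \<beta>)"
      using sys \<beta>(2) by (simp add: inverse_system_def)
    moreover have "openin (Ks i) (B i)" using i B(2) by (simp add: F_def)
    ultimately show "openin (Ks \<beta>) {w \<in> topspace (Ks \<beta>). p i \<beta> w \<in> B i}"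
      by (rule openin_continuous_map_preimage)
  qed
  moreover have "x \<beta> \<in> W"
  proof -
    have "x \<beta> \<in> topspace (Ks \<beta>)"
      using PiE_mem[OF B(3) \<beta>T] openin_subset[OF B(2)[rule_format, OF \<beta>T]] by blast
    moreover have "p i \<beta> (x \<beta>) \<in> B i" if "i \<in> F" for i
    proof -
      have "i \<in> T" using that by (simp add: F_def)
      then have "x i = p i \<beta> (x \<beta>)" using U(2) V(2) \<beta>(2) \<beta>T that by blast
      then show ?thesis using PiE_mem[OF B(3) \<open>i \<in> T\<close>] by simp
    qed
    ultimately show ?thesis by (simp add: W_def)
  qed
  moreover have "z \<in> U" if z: "z \<in> topspace (inverse_limit T Ks p)" "z \<beta> \<in> W" for z
  proof -
    have "z i \<in> B i" if "i \<in> T" for i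
    proof (cases "i \<in> F")
      case True
      then have "z i = p i \<beta> (z \<beta>)"
        using z(1) \<beta> \<beta>T that by (auto simp: topspace_inverse_limit)
      then show ?thesis using True z(2) by (auto simp: W_def)
    next
      case False
      then show ?thesis using z(1) that by (auto simp: topspace_inverse_limit F_def)
    qed
    then have "z \<in> Pi\<^sub>E T B"
      using z(1) by (auto simp: topspace_inverse_limit PiE_iff)
    then show ?thesis
      using B(4) V(2) z(1) by (auto simp: topspace_inverse_limit)
  qed
  ultimately show ?thesis using \<beta>T by blast
qed

lemma is_inverse_limit_thread:
  assumes "is_inverse_limit X q T Ks p" "x \<in> topspace X"
  shows "(\<lambda>s\<in>T. q s x) \<in> topspace (inverse_limit T Ks p)"
  using assms homeomorphic_imp_surjective_map unfolding is_inverse_limit_def by blast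

lemma is_inverse_limit_compat:
  assumes "is_inverse_limit X q T Ks p" "x \<in> topspace X" "\<alpha> \<in> T" "\<beta> \<in> T" "(\<alpha>, \<beta>) \<in> omega1"
  shows "q \<alpha> x = p \<alpha> \<beta> (q \<beta> x)"
  using is_inverse_limit_thread[OF assms(1,2)] assms(3-) by (auto simp: topspace_inverse_limit)

lemma is_inverse_limit_projection:
  assumes "is_inverse_limit X q T Ks p" "\<alpha> \<in> T"
  shows "continuous_map X (Ks \<alpha>) (q \<alpha>)"
proof -
  have "continuous_map X (product_topology Ks T) (\<lambda>x. \<lambda>s\<in>T. q s x)"
    using homeomorphic_imp_continuous_map[OF assms(1)[unfolded is_inverse_limit_def]]
    by (simp add: inverse_limit_def continuous_map_in_subtopology)
  then have "continuous_map X (Ks \<alpha>) (\<lambda>x. (\<lambda>s\<in>T. q s x) \<alpha>)"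
    using assms(2) by (simp add: continuous_map_componentwise)
  then show ?thesis using assms(2) by simp
qed

lemma is_inverse_limit_nhd:
  assumes sys: "inverse_system Ks p" and T: "T \<subseteq> Field omega1" "T \<noteq> {}"
    and lim: "is_inverse_limit X q T Ks p" and U: "openin X U" "x \<in> U"
  shows "\<exists>\<beta>\<in>T. \<exists>W. openin (Ks \<beta>) W \<and> q \<beta> x \<in> W \<and> (\<forall>z\<in>topspace X. q \<beta> z \<in> W \<longrightarrow> z \<in> U)"
proof -
  let ?h = "\<lambda>x. \<lambda>s\<in>T. q s x"
  have hom: "homeomorphic_map X (inverse_limit T Ks p) ?h"
    using lim by (simp add: is_inverse_limit_def)
  have "openin (inverse_limit T Ks p) (?h ` U)"
    using hom U(1) homeomorphic_imp_open_map open_map_def by blast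
  moreover have "?h x \<in> ?h ` U" using U(2) by (rule imageI)
  ultimately obtain \<beta> W where \<beta>: "\<beta> \<in> T" "openin (Ks \<beta>) W" "?h x \<beta> \<in> W"
      "\<forall>z\<in>topspace (inverse_limit T Ks p). z \<beta> \<in> W \<longrightarrow> z \<in> ?h ` U"
    using inverse_limit_nhd[OF sys T, of "?h ` U" "?h x"] by blast
  have "z \<in> U" if z: "z \<in> topspace X" "q \<beta> z \<in> W" for z
  proof -
    have "?h z \<in> ?h ` U"
      using \<beta>(1,4) is_inverse_limit_thread[OF lim z(1)] z(2) by auto
    then show ?thesis
      using homeomorphic_imp_injective_map[OF hom] z(1) openin_subset[OF U(1)]
      by (meson inj_on_image_mem_iff)
  qed
  then show ?thesis using \<beta> by auto
qed

text \<open>Compactness argument: each thread condition defines a closed subset of the product, and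
  any finitely many of them can be met together with the prescribed coordinate \<open>x\<close>, by
  pushing a preimage of \<open>x\<close> down from a late stage.\<close>

lemma is_inverse_limit_projection_onto:
  assumes sys: "inverse_system Ks p"
    and Ks: "\<And>\<alpha>. \<alpha> \<in> Field omega1 \<Longrightarrow> compact_space (Ks \<alpha>) \<and> Hausdorff_space (Ks \<alpha>)"
    and lim: "is_inverse_limit X q (Field omega1) Ks p"
    and \<beta>: "\<beta> \<in> Field omega1"
  shows "q \<beta> ` topspace X = topspace (Ks \<beta>)"
proof
  show "q \<beta> ` topspace X \<subseteq> topspace (Ks \<beta>)"
    using is_inverse_limit_projection[OF lim \<beta>] by (simp add: continuous_map_image_subset_topspace)
  show "topspace (Ks \<beta>) \<subseteq> q \<beta> ` topspace X"
  proof
    fix x assume x: "x \<in> topspace (Ks \<beta>)"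
    let ?P = "product_topology Ks (Field omega1)"
    define E where "E = (\<lambda>(\<alpha>, \<gamma>). {y \<in> topspace ?P. y \<beta> = x} \<inter> {y \<in> topspace ?P. y \<alpha> = p \<alpha> \<gamma> (y \<gamma>)})"
    have comp: "compact_space ?P"
      using Ks by (simp add: compact_space_product_topology)
    have proj: "continuous_map ?P (Ks \<alpha>) (\<lambda>y. y \<alpha>)" if "\<alpha> \<in> Field omega1" for \<alpha>
      using that by (rule continuous_map_product_projection)
    have bond: "continuous_map (Ks \<gamma>) (Ks \<alpha>) (p \<alpha> \<gamma>)" "p \<alpha> \<gamma> ` topspace (Ks \<gamma>) = topspace (Ks \<alpha>)"
      if "(\<alpha>, \<gamma>) \<in> omega1" for \<alpha> \<gamma>
      using sys that by (auto simp: inverse_system_def)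
    have comp_bond: "p \<alpha> \<delta> z = p \<alpha> \<gamma> (p \<gamma> \<delta> z)"
      if "(\<alpha>, \<gamma>) \<in> omega1" "(\<gamma>, \<delta>) \<in> omega1" "z \<in> topspace (Ks \<delta>)" for \<alpha> \<gamma> \<delta> z
      using sys that unfolding inverse_system_def by blast
    have closed: "closedin ?P (E e)" if "e \<in> omega1" for e
    proof -
      obtain \<alpha> \<gamma> where e: "e = (\<alpha>, \<gamma>)" by (cases e)
      have ag: "\<alpha> \<in> Field omega1" "\<gamma> \<in> Field omega1" using omega1_Field that e by auto
      have "continuous_map ?P (Ks \<alpha>) (\<lambda>y. p \<alpha> \<gamma> (y \<gamma>))"
        using continuous_map_compose[OF proj[OF ag(2)] bond(1)] that e by (simp add: o_def)
      then have "closedin ?P {y \<in> topspace ?P. y \<alpha> = p \<alpha> \<gamma> (y \<gamma>)}"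
        using closedin_continuous_maps_eq proj ag Ks by blast
      moreover have "closedin ?P {y \<in> topspace ?P. y \<beta> = x}"
        using closedin_continuous_maps_eq[of "Ks \<beta>" ?P "\<lambda>y. y \<beta>" "\<lambda>_. x"] proj \<beta> Ks x by simp
      ultimately show ?thesis by (auto simp: E_def e)
    qed
    have fip: "\<Inter>(E ` F) \<noteq> {}" if F: "finite F" "F \<subseteq> omega1" for F
    proof -
      have "finite (insert \<beta> (fst ` F \<union> snd ` F))" "insert \<beta> (fst ` F \<union> snd ` F) \<subseteq> Field omega1"
        using F \<beta> omega1_Field by auto
      from finite_max_omega1[OF this(1) _ this(2)] obtain \<delta>
        where \<delta>: "\<delta> \<in> Field omega1" "(\<beta>, \<delta>) \<in> omega1"
          "\<And>e. e \<in> F \<Longrightarrow> (fst e, \<delta>) \<in> omega1 \<and> (snd e, \<delta>) \<in> omega1"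
        using omega1_Field by (metis (no_types, lifting) UnI1 UnI2 image_eqI insertCI insert_not_empty)
      obtain z where z: "z \<in> topspace (Ks \<delta>)" "p \<beta> \<delta> z = x"
        using bond(2)[OF \<delta>(2)] x by (metis imageE)
      have nonempty: "topspace (Ks \<epsilon>) \<noteq> {}" if "\<epsilon> \<in> Field omega1" for \<epsilon>
        using bond(2)[of \<beta> \<epsilon>] bond(2)[of \<epsilon> \<beta>] omega1_total[OF that \<beta>] x by auto
      \<comment> \<open>Indices in \<open>F\<close> and \<beta> itself lie below \<delta>, so the
        arbitrary values chosen at all other stages violate none of the conditions in
        \<open>F\<close>.\<close>
      define y where "y = (\<lambda>\<epsilon>\<in>Field omega1. if (\<epsilon>, \<delta>) \<in> omega1 then p \<epsilon> \<delta> z else SOME w. w \<in> topspace (Ks \<epsilon>))"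
      have "y \<epsilon> \<in> topspace (Ks \<epsilon>)" if "\<epsilon> \<in> Field omega1" for \<epsilon>
        using that z(1) bond(2)[of \<epsilon> \<delta>] nonempty[OF that] by (auto simp: y_def some_in_eq)
      then have "y \<in> topspace ?P" by (simp add: y_def PiE_iff)
      moreover have "y \<beta> = x" using \<delta>(2) z(2) \<beta> by (simp add: y_def)
      moreover have "y \<alpha> = p \<alpha> \<gamma> (y \<gamma>)" if "(\<alpha>, \<gamma>) \<in> F" for \<alpha> \<gamma>
        using \<delta>(3)[OF that] F(2) that comp_bond[of \<alpha> \<gamma> \<delta> z] z(1) omega1_Field[of \<alpha> \<gamma>]
        by (auto simp: y_def)
      ultimately have "y \<in> \<Inter>(E ` F)" by (auto simp: E_def)
      then show ?thesis by blast
    qed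
    have "\<Inter>\<F> \<noteq> {}" if "finite \<F> \<and> \<F> \<subseteq> E ` omega1" for \<F>
      using that fip by (metis finite_subset_image)
    then have "\<Inter>(E ` omega1) \<noteq> {}"
      using comp[unfolded compact_space_fip, rule_format, of "E ` omega1"] closed by blast
    then obtain y where y: "\<And>e. e \<in> omega1 \<Longrightarrow> y \<in> E e" by blast
    \<comment> \<open>The condition on the \<beta>-coordinate is built into every
      \<open>E e\<close>; reflexivity supplies one pair from which to read it off.\<close>
    then have "y \<in> topspace ?P" "y \<beta> = x"
      using y[OF omega1_refl[OF \<beta>]] by (auto simp: E_def)
    moreover have "y \<alpha> = p \<alpha> \<gamma> (y \<gamma>)" if "(\<alpha>, \<gamma>) \<in> omega1" for \<alpha> \<gamma>
      using y[OF that] by (auto simp: E_def)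
    ultimately have "y \<in> topspace (inverse_limit (Field omega1) Ks p)"
      by (simp add: topspace_inverse_limit)
    then obtain w where "w \<in> topspace X" "y = (\<lambda>s\<in>Field omega1. q s w)"
      using homeomorphic_imp_surjective_map[OF lim[unfolded is_inverse_limit_def]] by blast
    then show "x \<in> q \<beta> ` topspace X"
      using \<open>y \<beta> = x\<close> \<beta> by auto
  qed
qed

section \<open>Countable bases and isolated points\<close>

lemma compact_metrizable_imp_second_countable:
  assumes "compact_space X" "metrizable_space X"
  shows "second_countable X"
proof -
  obtain M d where "Metric_space M d" and X: "X = Metric_space.mtopology M d"
    using assms(2) unfolding metrizable_space_def by blast
  interpret Metric_space M d by fact
  \<comment> \<open>Total boundedness provides finite nets for the radii 1/(n+1); the balls around
    their points will form a countable base.\<close>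
  have "\<exists>A. finite A \<and> A \<subseteq> M \<and> M \<subseteq> (\<Union>a\<in>A. mball a (1 / Suc n))" for n
    using compactin_imp_mtotally_bounded[of M] assms(1) X
    by (simp add: mtotally_bounded_def compact_space_def)
  then obtain A where A: "\<And>n. finite (A n)" "\<And>n. A n \<subseteq> M"
      "\<And>n. M \<subseteq> (\<Union>a\<in>A n. mball a (1 / Suc n))" by metis
  define \<B> where "\<B> = (\<Union>n. (\<lambda>a. mball a (1 / Suc n)) ` A n)"
  have "countable \<B>" unfolding \<B>_def using A(1) by (simp add: countable_finite)
  moreover have "\<forall>V\<in>\<B>. openin X V" unfolding \<B>_def X by auto
  moreover have "\<exists>V\<in>\<B>. x \<in> V \<and> V \<subseteq> U" if U: "openin X U" "x \<in> U" for U x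
  proof -
    obtain r where r: "r > 0" "mball x r \<subseteq> U" and x: "x \<in> M"
      using U unfolding X openin_mtopology by blast
    obtain n where n: "1 / real (Suc n) < r / 2"
      using r(1) by (metis half_gt_zero nat_approx_posE)
    obtain a where a: "a \<in> A n" "x \<in> mball a (1 / Suc n)" using A(3) x by blast
    have "mball a (1 / Suc n) \<subseteq> mball x r"
    proof
      fix y assume y: "y \<in> mball a (1 / Suc n)"
      then have "d x y \<le> d a x + d a y" using triangle[of x a y] a(2) by (auto simp: commute)
      then show "y \<in> mball x r" using y a(2) n by auto
    qed
    then show ?thesis using a r(2) unfolding \<B>_def by blast
  qed
  ultimately show ?thesis unfolding second_countable_def by blast
qed

lemma second_countable_imp_countable_isolated:
  assumes "second_countable X"
  shows "countable {x. openin X {x}}"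
proof -
  obtain \<B> where \<B>: "countable \<B>" "\<forall>U x. openin X U \<and> x \<in> U \<longrightarrow> (\<exists>V\<in>\<B>. x \<in> V \<and> V \<subseteq> U)"
    using assms unfolding second_countable_def by blast
  \<comment> \<open>The only nonempty subset of a singleton is the singleton itself, so every base
    contains each open singleton.\<close>
  have "{x} \<in> \<B>" if "openin X {x}" for x
    using \<B>(2) that by (metis insertI1 subset_singletonD empty_iff)
  then have "(\<lambda>x. {x}) ` {x. openin X {x}} \<subseteq> \<B>" by blast
  then show ?thesis
    using \<B>(1) countable_subset countable_image_inj_on[of "\<lambda>x. {x}"] by (metis inj_singleton inj_on_subset subset_UNIV)
qed

section \<open>Countability of the isolated points of a scattered space in the class\<close>

lemma scattered_open_isolated:
  assumes "scattered_space X" "openin X U" "U \<noteq> {}"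
  shows "\<exists>x\<in>U. openin X {x}"
  using assms openin_subset[OF assms(2)] openin_trans_full unfolding scattered_space_def by blast

lemma class_RS_scattered_countable_isolated:
  assumes RS: "class_RS TYPE('b) K" and sc: "scattered_space K"
  shows "countable {x. openin K {x}}"
proof -
  obtain Ks :: "nat set \<Rightarrow> 'b topology" and p q where sys: "inverse_system Ks p"
    and cont: "continuous_system Ks p"
    and Ks: "\<And>\<alpha>. \<alpha> \<in> Field omega1 \<Longrightarrow> compact_space (Ks \<alpha>) \<and> metrizable_space (Ks \<alpha>)"
    and semi: "\<And>\<alpha> \<beta>. (\<alpha>, \<beta>) \<in> omega1 \<Longrightarrow> semi_open_map (Ks \<beta>) (Ks \<alpha>) (p \<alpha> \<beta>)"
    and lim: "is_inverse_limit K q (Field omega1) Ks p"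
    using RS unfolding class_RS_def by blast
  define I where "I = {x. openin K {x}}"
  have I_sub: "x \<in> topspace K" if "x \<in> I" for x
    using that openin_subset unfolding I_def by blast
  have onto: "q \<alpha> ` topspace K = topspace (Ks \<alpha>)" if "\<alpha> \<in> Field omega1" for \<alpha>
    using is_inverse_limit_projection_onto[OF sys _ lim that] Ks metrizable_imp_Hausdorff_space by blast
  have compat: "q \<alpha> x = p \<alpha> \<beta> (q \<beta> x)" if "(\<alpha>, \<beta>) \<in> omega1" "x \<in> topspace K" for \<alpha> \<beta> x
    using is_inverse_limit_compat[OF lim] that omega1_Field by blast
  \<comment> \<open>Some stage has an open \<open>W\<close> whose preimage is contained in {x};
    since the projection is onto, \<open>W\<close> itself is a singleton.\<close>
  have single: "\<exists>\<beta>\<in>Field omega1. openin (Ks \<beta>) {q \<beta> x} \<and> (\<forall>z\<in>topspace K. q \<beta> z = q \<beta> x \<longrightarrow> z = x)"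
    if x: "x \<in> I" for x
  proof -
    obtain \<beta> W where \<beta>: "\<beta> \<in> Field omega1" "openin (Ks \<beta>) W" "q \<beta> x \<in> W"
        "\<forall>z\<in>topspace K. q \<beta> z \<in> W \<longrightarrow> z = x"
      using is_inverse_limit_nhd[OF sys subset_refl Field_omega1_nonempty lim x[unfolded I_def mem_Collect_eq]]
      by auto
    have "w = q \<beta> x" if w: "w \<in> W" for w
    proof -
      have "w \<in> q \<beta> ` topspace K"
        using onto[OF \<beta>(1)] openin_subset[OF \<beta>(2)] w by blast
      then show ?thesis using \<beta>(4) w by blast
    qed
    then have "W = {q \<beta> x}" using \<beta>(3) by blast
    then show ?thesis using \<beta> by blast
  qed
  \<comment> \<open>Fibres shrink as the stage grows, so a point alone in its fibre stays alone at
    all later stages.\<close>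
  have fibre_mono: "z = x" if "(\<alpha>, \<beta>) \<in> omega1" "\<forall>z\<in>topspace K. q \<alpha> z = q \<alpha> x \<longrightarrow> z = x"
      "x \<in> topspace K" "z \<in> topspace K" "q \<beta> z = q \<beta> x" for \<alpha> \<beta> x z
    using that compat by metis
  \<comment> \<open>Take a stage \<beta> where \<open>x\<close> is alone in its fibre. Below
    \<beta>, semi-openness gives the image of an open singleton nonempty interior; above \<beta>,
    the open singleton at \<beta> has a singleton as its preimage under the bonding map.\<close>
  have iso: "openin (Ks \<alpha>) {q \<alpha> x}" if x: "x \<in> I" and \<alpha>: "\<alpha> \<in> Field omega1" for x \<alpha>
  proof -
    obtain \<beta> where \<beta>: "\<beta> \<in> Field omega1" "openin (Ks \<beta>) {q \<beta> x}"
        "\<forall>z\<in>topspace K. q \<beta> z = q \<beta> x \<longrightarrow> z = x"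
      using single[OF x] by blast
    show ?thesis
    proof (cases "(\<alpha>, \<beta>) \<in> omega1")
      case True
      then have "Ks \<alpha> interior_of {q \<alpha> x} \<noteq> {}"
        using semi[OF True] \<beta>(2) compat[OF True I_sub[OF x]]
        unfolding semi_open_map_def by force
      then show ?thesis
        by (metis interior_of_subset openin_interior_of subset_singletonD)
    next
      case False
      then have le: "(\<beta>, \<alpha>) \<in> omega1" using omega1_total \<alpha> \<beta>(1) by blast
      have "{w \<in> topspace (Ks \<alpha>). p \<beta> \<alpha> w \<in> {q \<beta> x}} = {q \<alpha> x}"
        unfolding onto[OF \<alpha>, symmetric] using compat[OF le] \<beta>(3) I_sub[OF x] by auto
      then show ?thesis
        using sys le \<beta>(2) openin_continuous_map_preimage[of "Ks \<alpha>" "Ks \<beta>" "p \<beta> \<alpha>" "{q \<beta> x}"]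
        by (simp add: inverse_system_def)
    qed
  qed
  \<comment> \<open>Stage \<beta> separates from all other points of \<open>K\<close> enough
    isolated points to meet every nonempty open set of stage \<alpha>.\<close>
  define good where "good \<alpha> \<beta> \<longleftrightarrow> (\<alpha>, \<beta>) \<in> omega1 \<and> (\<forall>U. openin (Ks \<alpha>) U \<and> U \<noteq> {} \<longrightarrow>
      (\<exists>x\<in>I. q \<alpha> x \<in> U \<and> (\<forall>z\<in>topspace K. q \<beta> z = q \<beta> x \<longrightarrow> z = x)))" for \<alpha> \<beta>
  have "\<exists>\<beta>. good \<alpha> \<beta>" if \<alpha>: "\<alpha> \<in> Field omega1" for \<alpha>
  proof -
    \<comment> \<open>A countable base reduces the requirement to one isolated point per nonempty
      basic set, hence to countably many stages, which have a common upper bound.\<close>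
    obtain \<B> where \<B>: "countable \<B>" "\<forall>V\<in>\<B>. openin (Ks \<alpha>) V"
        "\<forall>U x. openin (Ks \<alpha>) U \<and> x \<in> U \<longrightarrow> (\<exists>V\<in>\<B>. x \<in> V \<and> V \<subseteq> U)"
      using compact_metrizable_imp_second_countable Ks[OF \<alpha>] unfolding second_countable_def by meson
    have "\<exists>x \<beta>. x \<in> I \<and> q \<alpha> x \<in> V \<and> \<beta> \<in> Field omega1 \<and> (\<forall>z\<in>topspace K. q \<beta> z = q \<beta> x \<longrightarrow> z = x)"
      if "V \<in> \<B> - {{}}" for V
    proof -
      have V: "openin (Ks \<alpha>) V" "V \<noteq> {}" using that \<B>(2) by auto
      have "openin K {z \<in> topspace K. q \<alpha> z \<in> V}"
        using is_inverse_limit_projection[OF lim \<alpha>] V(1) by (rule openin_continuous_map_preimage)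
      moreover have "{z \<in> topspace K. q \<alpha> z \<in> V} \<noteq> {}"
        using V(2) openin_subset[OF V(1)] unfolding onto[OF \<alpha>, symmetric] by blast
      ultimately obtain x where "x \<in> I" "q \<alpha> x \<in> V"
        using scattered_open_isolated[OF sc] unfolding I_def by blast
      then show ?thesis using single by blast
    qed
    then obtain x b where xb: "\<And>V. V \<in> \<B> - {{}} \<Longrightarrow> x V \<in> I \<and> q \<alpha> (x V) \<in> V \<and> b V \<in> Field omega1
        \<and> (\<forall>z\<in>topspace K. q (b V) z = q (b V) (x V) \<longrightarrow> z = x V)" by metis
    have "countable (insert \<alpha> (b ` (\<B> - {{}})))" "insert \<alpha> (b ` (\<B> - {{}})) \<subseteq> Field omega1"
      using \<B>(1) xb \<alpha> by auto
    from countable_bounded_omega1[OF this] obtain \<beta> where \<beta>: "(\<alpha>, \<beta>) \<in> omega1"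
        "\<And>V. V \<in> \<B> - {{}} \<Longrightarrow> (b V, \<beta>) \<in> omega1" by auto
    have "\<exists>x\<in>I. q \<alpha> x \<in> U \<and> (\<forall>z\<in>topspace K. q \<beta> z = q \<beta> x \<longrightarrow> z = x)"
      if "openin (Ks \<alpha>) U" "U \<noteq> {}" for U
    proof -
      obtain V where V: "V \<in> \<B> - {{}}" "V \<subseteq> U" using \<B>(3) \<open>openin (Ks \<alpha>) U\<close> \<open>U \<noteq> {}\<close> by blast
      have "\<forall>z\<in>topspace K. q \<beta> z = q \<beta> (x V) \<longrightarrow> z = x V"
        using fibre_mono[OF \<beta>(2)[OF V(1)]] xb[OF V(1)] I_sub by blast
      then show ?thesis using xb[OF V(1)] V(2) by blast
    qed
    then show ?thesis using \<beta>(1) by (auto simp: good_def)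
  qed
  then obtain f where f: "\<And>\<alpha>. \<alpha> \<in> Field omega1 \<Longrightarrow> good \<alpha> (f \<alpha>)" by metis
  obtain \<alpha>0 where \<alpha>0: "\<alpha>0 \<in> Field omega1" using Field_omega1_nonempty by blast
  \<comment> \<open>The iteration catches up with itself at the supremum \<open>t\<close>: what is
    open at stage \<open>a n\<close> is handled at stage \<open>a (Suc n)\<close>, which is still at
    or below \<open>t\<close>.\<close>
  define a where "a n = (f ^^ n) \<alpha>0" for n
  have f_Field: "f \<alpha> \<in> Field omega1" if "\<alpha> \<in> Field omega1" for \<alpha>
    using f[OF that] omega1_Field(2) unfolding good_def by blast
  have a_Field: "a n \<in> Field omega1" for n
    by (induction n) (simp_all add: a_def \<alpha>0 f_Field)
  have a_good: "good (a n) (a (Suc n))" for n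
    using f[OF a_Field[of n]] by (simp add: a_def)
  obtain t where t: "is_sup_omega1 (range a) t"
    using countable_sup_omega1[of "range a"] a_Field by auto
  then have tF: "t \<in> Field omega1" and at: "\<And>n. (a n, t) \<in> omega1" by (auto simp: is_sup_omega1_def)
  have range_a: "range a \<subseteq> Field omega1" "range a \<noteq> {}" using a_Field by auto
  then have lim_t: "is_inverse_limit (Ks t) (\<lambda>s. p s t) (range a) Ks p"
    using cont[unfolded continuous_system_def, rule_format, of "range a" t] t by simp
  have fibre_t: "z = y" if y: "y \<in> I" and z: "z \<in> topspace K" "q t z = q t y" for y z
  proof -
    \<comment> \<open>Continuity of the system makes \<open>Ks t\<close> the limit over
      \<open>range a\<close>, so its isolated point \<open>q t y\<close> is already cut out by an
      open set at some stage \<open>a n\<close>.\<close>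
    obtain n W where W: "openin (Ks (a n)) W" "p (a n) t (q t y) \<in> W"
        "\<forall>w\<in>topspace (Ks t). p (a n) t w \<in> W \<longrightarrow> w = q t y"
      using is_inverse_limit_nhd[OF sys range_a lim_t iso[OF y tF]] by auto
    then obtain x where x: "x \<in> I" "q (a n) x \<in> W"
        "\<forall>z\<in>topspace K. q (a (Suc n)) z = q (a (Suc n)) x \<longrightarrow> z = x"
      using a_good[of n] unfolding good_def by blast
    \<comment> \<open>The point \<open>q t x\<close> projects into \<open>W\<close>, and
      \<open>q t y\<close> is the only point of \<open>Ks t\<close> that does.\<close>
    have qx: "q t x = q t y"
      using W(3) x(2) compat[OF at I_sub[OF x(1)]] I_sub[OF x(1)]
      unfolding onto[OF tF, symmetric] by auto
    \<comment> \<open>Since \<open>x\<close> is alone in its fibre at \<open>a (Suc n)\<close>, it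
      is alone at \<open>t\<close>; both \<open>z\<close> and \<open>y\<close> lie in that
      fibre.\<close>
    have "z = x" by (rule fibre_mono[OF at x(3) I_sub[OF x(1)] z(1)]) (simp add: z(2) qx)
    moreover have "y = x" by (rule fibre_mono[OF at x(3) I_sub[OF x(1)] I_sub[OF y]]) (simp add: qx)
    ultimately show ?thesis by simp
  qed
  have "inj_on (q t) I"
    using fibre_t I_sub by (meson inj_onI)
  moreover have "q t ` I \<subseteq> {w. openin (Ks t) {w}}" using iso tF by blast
  moreover have "countable {w. openin (Ks t) {w}}"
    using second_countable_imp_countable_isolated compact_metrizable_imp_second_countable Ks[OF tF] by blast
  ultimately show ?thesis
    unfolding I_def[symmetric] by (meson countable_image_inj_on countable_subset)
qed

section \<open>Metrizability from a countable dense set of countably supported points\<close>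

lemma metrizable_if_dense_countable_support:
  assumes X: "compact_space X" and f: "continuous_map X (real_power \<Gamma>) f" and inj: "inj_on f (topspace X)"
    and D: "countable D" "f ` D \<subseteq> big_Sigma \<Gamma>" "X closure_of D = topspace X"
  shows "metrizable_space X"
proof -
  define G where "G = (\<Union>x\<in>D. suppt \<Gamma> (f x))"
  have G: "countable G" "G \<subseteq> \<Gamma>"
    using D(1,2) by (auto simp: G_def big_Sigma_def suppt_def)
  have coord: "continuous_map X euclideanreal (\<lambda>x. f x \<gamma>)" if "\<gamma> \<in> \<Gamma>" for \<gamma>
    using f that unfolding real_power_def continuous_map_componentwise by blast
  \<comment> \<open>A coordinate outside \<open>G\<close> vanishes on \<open>D\<close>; being
    continuous with Hausdorff range, it vanishes on the closure of \<open>D\<close>, which is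
    everything.\<close>
  have zero: "f x \<gamma> = 0" if "x \<in> topspace X" "\<gamma> \<in> \<Gamma> - G" for x \<gamma>
  proof (rule forall_in_closure_of_eq[where f = "\<lambda>x. f x \<gamma>" and g = "\<lambda>_. 0"])
    show "x \<in> X closure_of D" using that D(3) by simp
    show "continuous_map X euclideanreal (\<lambda>x. f x \<gamma>)" using coord that by blast
  qed (use that in \<open>auto simp: G_def suppt_def\<close>)
  let ?Y = "product_topology (\<lambda>_. euclideanreal) G"
  \<comment> \<open>Restricting to \<open>G\<close> drops only zero coordinates and so stays
    injective. An injective continuous map from a compact space into the metrizable countable power
    \<open>?Y\<close> is an embedding.\<close>
  let ?g = "\<lambda>x. restrict (f x) G"
  have "continuous_map X ?Y ?g"
    unfolding continuous_map_componentwise using coord G(2) by auto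
  moreover have "inj_on ?g (topspace X)"
  proof (rule inj_onI)
    fix x y assume xy: "x \<in> topspace X" "y \<in> topspace X" "?g x = ?g y"
    have "f x \<in> extensional \<Gamma>" "f y \<in> extensional \<Gamma>"
      using continuous_map_image_subset_topspace[OF f] xy(1,2)
      by (auto simp: real_power_def PiE_iff)
    moreover have "f x \<gamma> = f y \<gamma>" if "\<gamma> \<in> \<Gamma>" for \<gamma>
      using that xy zero by (cases "\<gamma> \<in> G") (metis restrict_apply', simp)
    ultimately have "f x = f y" by (rule extensionalityI)
    then show "x = y" using inj xy(1,2) by (meson inj_onD)
  qed
  moreover have Y: "metrizable_space ?Y"
    using G(1) by (auto simp: metrizable_space_product_topology metrizable_space_euclidean
        intro: countable_subset[of _ G])
  ultimately have "embedding_map X ?Y ?g"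
    using X metrizable_imp_Hausdorff_space continuous_imp_embedding_map by blast
  then have "X homeomorphic_space subtopology ?Y (?g ` topspace X)"
    using embedding_map_imp_homeomorphic_space by blast
  then show ?thesis
    using homeomorphic_metrizable_space metrizable_space_subtopology[OF Y] by blast
qed

text \<open>A common form of both claims. The given dense set \<open>D\<close> may be uncountable,
  so it is replaced by the set of isolated points: this is countable, dense because the space is
  scattered, and contained in \<open>D\<close>.\<close>

lemma class_RS_scattered_metrizable:
  assumes RS: "class_RS TYPE('b) X" and sc: "scattered_space X"
    and f: "continuous_map X (real_power \<Gamma>) f" "inj_on f (topspace X)"
    and D: "D \<subseteq> topspace X" "X closure_of D = topspace X" "f ` D \<subseteq> big_Sigma \<Gamma>"
  shows "metrizable_space X"
proof (rule metrizable_if_dense_countable_support[OF _ f])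
  show "compact_space X" using RS by (simp add: class_RS_def)
  show "countable {x. openin X {x}}"
    by (rule class_RS_scattered_countable_isolated[OF RS sc])
  \<comment> \<open>An open singleton must meet the dense set \<open>D\<close>.\<close>
  have "x \<in> D" if x: "openin X {x}" for x
  proof -
    have "x \<in> X closure_of D" using D(2) openin_subset[OF x] by simp
    then show ?thesis using x unfolding in_closure_of by blast
  qed
  then show "f ` {x. openin X {x}} \<subseteq> big_Sigma \<Gamma>" using D(3) by blast
  show "X closure_of {x. openin X {x}} = topspace X"
    unfolding dense_intersects_open using scattered_open_isolated[OF sc] by blast
qed

theorem corollary3p8:
  fixes \<Gamma> :: "'i set" and K :: "('i \<Rightarrow> real) set" and X :: "'a topology"
  shows "(K \<subseteq> two_power \<Gamma> \<and> compactin (real_power \<Gamma>) K \<and>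
          \<not> metrizable_space (subtopology (real_power \<Gamma>) K) \<and>
          scattered_space (subtopology (real_power \<Gamma>) K) \<and>
          (subtopology (real_power \<Gamma>) K) closure_of (small_sigma \<Gamma> \<inter> K) = K
          \<longrightarrow> \<not> class_RS TYPE('b) (subtopology (real_power \<Gamma>) K))
       \<and> (Corson_compact TYPE('j) X \<and> scattered_space X \<and> \<not> metrizable_space X
          \<longrightarrow> \<not> class_RS TYPE('c) X)"
proof (intro conjI impI notI)
  let ?S = "subtopology (real_power \<Gamma>) K"
  assume K: "K \<subseteq> two_power \<Gamma> \<and> compactin (real_power \<Gamma>) K \<and> \<not> metrizable_space ?S \<and>
      scattered_space ?S \<and> ?S closure_of (small_sigma \<Gamma> \<inter> K) = K"
    and RS: "class_RS TYPE('b) ?S"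
  have top: "topspace ?S = K"
    using K compactin_subset_topspace by fastforce
  have "metrizable_space ?S"
  \<comment> \<open>The embedding is the inclusion, and finite supports are countable.\<close>
  proof (rule class_RS_scattered_metrizable[OF RS, where f = "\<lambda>x. x" and D = "small_sigma \<Gamma> \<inter> K"])
    show "continuous_map ?S (real_power \<Gamma>) (\<lambda>x. x)"
      using continuous_map_from_subtopology[OF continuous_map_id] by (simp add: id_def)
    show "(\<lambda>x. x) ` (small_sigma \<Gamma> \<inter> K) \<subseteq> big_Sigma \<Gamma>"
      by (auto simp: small_sigma_def big_Sigma_def countable_finite)
  qed (use K top in auto)
  then show False using K by blast
next
  assume X: "Corson_compact TYPE('j) X \<and> scattered_space X \<and> \<not> metrizable_space X"
    and RS: "class_RS TYPE('c) X"
  obtain \<Delta> :: "'j set" and C where C: "C \<subseteq> big_Sigma \<Delta>" "X homeomorphic_space subtopology (real_power \<Delta>) C"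
    using X unfolding Corson_compact_def by blast
  then obtain h where h: "homeomorphic_map X (subtopology (real_power \<Delta>) C) h"
    using homeomorphic_space by blast
  have "metrizable_space X"
  \<comment> \<open>Every point of a Corson compactum is sent to a countably supported one, so the
    whole space serves as the dense set.\<close>
  proof (rule class_RS_scattered_metrizable[OF RS, where f = h and D = "topspace X"])
    show "continuous_map X (real_power \<Delta>) h"
      using homeomorphic_imp_continuous_map[OF h] continuous_map_in_subtopology by blast
    show "inj_on h (topspace X)" using homeomorphic_imp_injective_map[OF h] .
    show "h ` topspace X \<subseteq> big_Sigma \<Delta>"
      using homeomorphic_imp_surjective_map[OF h] C(1) by auto
  qed (use X in auto)
  then show False using X by blast
qed

end
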